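(* Let $\mathscr{M}=(X,\mathcal{I})$ be a matroid, let $1\le k<\mathrm{rk}(\mathscr{M})$, and let $\omega:X\to\mathbb{R}_{>0}$ be a weight function. Then $$\mathrm{I}_\omega(k)^2\ =\ \Bigl(1+\frac1k\Bigr)\Bigl(1+\frac{1}{p(k-1)-1}\Bigr)\,\mathrm{I}_\omega(k-1)\,\mathrm{I}_\omega(k+1)$$ if and only if there exists a constant $s>0$ (depending only on $\mathscr M,\omega,k$) such that for every $S\in\mathcal I_{k-1}$ we have $$|\mathrm{Par}(S)|=p(k-1)\qquad\text{and}\qquad \sum_{x\in\mathcal C}\omega(x)=s\ \text{ for every }\mathcal C\in\mathrm{Par}(S).$$
   Context: A matroid $\mathscr{M}=(X,\mathcal{I})$ is given by its finite ground set $X$ and its collection $\mathcal I\subseteq 2^X$ of independent sets; $\mathrm{rk}(\mathscr M)$ is the maximal size of an independent set; $\mathcal I_j=\{S\in\mathcal I: |S|=j\}$. For $\omega:X\to\mathbb R_{>0}$ put $\omega(S)=\prod_{x\in S}\omega(x)$ and $\mathrm I_\omega(j)=\sum_{S\in\mathcal I_j}\omega(S)$. For $S\in\mathcal I$, the set of continuations is $\mathrm{Cont}(S)=\{x\in X\setminus S: S\cup\{x\}\in\mathcal I\}$. For $x,y\in\mathrm{Cont}(S)$ write $x\sim_S y$ if $x=y$ or $S\cup\{x,y\}\notin\mathcal I$; this is an equivalence relation on $\mathrm{Cont}(S)$. Its equivalence classes are called parallel classes of $S$, and $\mathrm{Par}(S)$ is the set of parallel classes. For $0\le j<\mathrm{rk}(\mathscr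 M)$, $p(j)=\max\{|\mathrm{Par}(S)|: S\in\mathcal I_j\}$. *)

theory Defs
  imports Complex_Main
begin

locale matroid =
  fixes X :: "'a set" and I :: "'a set set"
  assumes finite_ground: "finite X"
    and indep_subset_ground: "S \<in> I \<Longrightarrow> S \<subseteq> X"
    and indep_empty: "{} \<in> I"
    and indep_subset: "T \<in> I \<Longrightarrow> S \<subseteq> T \<Longrightarrow> S \<in> I"
    and augmentation: "S \<in> I \<Longrightarrow> T \<in> I \<Longrightarrow> card S < card T \<Longrightarrow> \<exists>x \<in> T - S. insert x S \<in> I"

definition rk :: "'a set set \<Rightarrow> nat"
  where "rk I = Max (card ` I)"

definition indep_size :: "'a set set \<Rightarrow> nat \<Rightarrow> 'a set set"
  where "indep_size I j = {S \<in> I. card S = j}"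

definition weighted_count :: "'a set set \<Rightarrow> ('a \<Rightarrow> real) \<Rightarrow> nat \<Rightarrow> real"
  where "weighted_count I \<omega> j = (\<Sum>S\<in>indep_size I j. \<Prod>x\<in>S. \<omega> x)"

definition Cont :: "'a set \<Rightarrow> 'a set set \<Rightarrow> 'a set \<Rightarrow> 'a set"
  where "Cont X I S = {x \<in> X - S. S \<union> {x} \<in> I}"

definition parallel :: "'a set \<Rightarrow> 'a set set \<Rightarrow> 'a set \<Rightarrow> ('a \<times> 'a) set"
  where "parallel X I S =
    {(x, y) \<in> Cont X I S \<times> Cont X I S. x = y \<or> S \<union> {x, y} \<notin> I}"

definition Par :: "'a set \<Rightarrow> 'a set set \<Rightarrow> 'a set \<Rightarrow> 'a set set"
  where "Par X I S = Cont X I S // parallel X I S"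

definition max_par :: "'a set \<Rightarrow> 'a set set \<Rightarrow> nat \<Rightarrow> nat"
  where "max_par X I j = Max ((\<lambda>S. card (Par X I S)) ` indep_size I j)"

lemma (in matroid) equiv_parallel:
  assumes S: "S \<in> I"
  shows "equiv (Cont X I S) (parallel X I S)"
proof (rule equivI)
  show "parallel X I S \<subseteq> Cont X I S \<times> Cont X I S"
    by (auto simp: parallel_def)
  show "refl_on (Cont X I S) (parallel X I S)"
    by (auto simp: refl_on_def parallel_def)
  show "sym (parallel X I S)"
    by (auto simp: sym_def parallel_def insert_commute)
  show "trans (parallel X I S)"
  proof (rule transI)
    fix x y z
    assume xy: "(x, y) \<in> parallel X I S" and yz: "(y, z) \<in> parallel X I S"
    have C: "x \<in> Cont X I S" "y \<in> Cont X I S" "z \<in> Cont X I S"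
      using xy yz by (auto simp: parallel_def)
    show "(x, z) \<in> parallel X I S"
    proof (rule ccontr)
      assume "(x, z) \<notin> parallel X I S"
      then have ne: "x \<noteq> z" and T: "S \<union> {x, z} \<in> I"
        using C by (auto simp: parallel_def)
      have nin: "x \<notin> S" "y \<notin> S" "z \<notin> S" and Sy: "S \<union> {y} \<in> I"
        using C by (auto simp: Cont_def)
      have fin: "finite S"
        using S finite_ground indep_subset_ground finite_subset by blast
      have "card (S \<union> {y}) < card (S \<union> {x, z})"
        using ne nin fin by simp
      then obtain w where w: "w \<in> (S \<union> {x, z}) - (S \<union> {y})" "insert w (S \<union> {y}) \<in> I"
        using augmentation[OF Sy T] by blast
      then have "w = x \<or> w = z" and "w \<noteq> y" by auto
      then show False
        using w xy yz by (auto simp: parallel_def insert_commute)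
    qed
  qed
qed

end

theory Submission
  imports Defs
begin

text \<open>
  Put \<open>\<beta> = 1 + 1 / (p(k - 1) - 1)\<close>. For independent \<open>S\<close> of size \<open>k - 1 - n\<close>, summing over ordered
  extensions gives a quadratic form on \<open>\<real>\<^sup>X \<oplus> \<real>\<close> whose values at \<open>S = {}\<close>, \<open>n = k - 1\<close> on \<open>(1, 0)\<close> and
  \<open>(0, 1)\<close> are \<open>(k + 1)! I\<^sub>\<omega>(k + 1)\<close> and \<open>\<beta> (k - 1)! I\<^sub>\<omega>(k - 1)\<close>, with mixed value \<open>k! I\<^sub>\<omega>(k)\<close>. The
  theorem concerns equality in the reversed Cauchy-Schwarz inequality for \<open>(1, 0)\<close>, that is,
  vanishing of a form which is nonpositive on the orthogonal complement of \<open>(1, 0)\<close>.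

  Nonpositivity is proved by induction on \<open>n\<close>. The form at \<open>S\<close> is the weighted sum of the forms at
  \<open>S \<union> {x}\<close>, and row \<open>x\<close> of its matrix is the form at \<open>S \<union> {x}\<close> against \<open>(1, 0)\<close>. Normalized by its
  row sums, the \<open>X\<close>-block becomes a reversible Markov operator \<open>B\<close>; the induction hypothesis
  gives \<open>B \<le> B\<^sup>2\<close>, connectedness gives a spectral gap at \<open>1\<close>, hence \<open>B \<le> 0\<close> on mean-zero functions.
  The last coordinate is handled by an ascent step along the gradient. This step also shows
  that a null vector orthogonal to \<open>(1, 0)\<close> has zero gradient, so the same vector is orthogonal and
  null for every \<open>S \<union> {x}\<close>. At \<open>n = 0\<close>, where the form depends only on the class sums,
  it forces all of them to be equal.
\<close>

section \<open>Reversible kernels\<close>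

text \<open>Edge weights of a finite weighted graph. \<open>two_steps\<close> is a quantitative
  connectedness: any two vertices are joined by at most two edges of weight at least \<kappa>. Taken
  at \<open>y = x\<close>, it makes all row sums positive.\<close>

locale reversible_kernel =
  fixes Y :: "'a set" and K :: "'a \<Rightarrow> 'a \<Rightarrow> real" and \<kappa> :: real
  assumes finite_Y: "finite Y"
    and K_sym: "x \<in> Y \<Longrightarrow> y \<in> Y \<Longrightarrow> K x y = K y x"
    and K_nonneg: "x \<in> Y \<Longrightarrow> y \<in> Y \<Longrightarrow> 0 \<le> K x y"
    and \<kappa>_pos: "0 < \<kappa>"
    and two_steps: "x \<in> Y \<Longrightarrow> y \<in> Y \<Longrightarrow> \<kappa> \<le> K x y \<or> (\<exists>z\<in>Y. \<kappa> \<le> K x z \<and> \<kappa> \<le> K z y)"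
begin

text \<open>\<open>w\<close> is the reversing measure of the random walk with edge weights
  \<open>K\<close>, \<open>ip\<close> the inner product it defines, and \<open>B\<close> the
  transition operator.\<close>

definition w :: "'a \<Rightarrow> real"
  where "w x = (\<Sum>y\<in>Y. K x y)"

definition ip :: "('a \<Rightarrow> real) \<Rightarrow> ('a \<Rightarrow> real) \<Rightarrow> real"
  where "ip u v = (\<Sum>x\<in>Y. w x * (u x * v x))"

definition B :: "('a \<Rightarrow> real) \<Rightarrow> 'a \<Rightarrow> real"
  where "B u x = (\<Sum>y\<in>Y. K x y * u y) / w x"

lemma w_pos: "x \<in> Y \<Longrightarrow> 0 < w x"
proof -
  assume x: "x \<in> Y"
  then obtain z where z: "z \<in> Y" "\<kappa> \<le> K x z" using two_steps by blast
  have "K x z \<le> w x"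
    unfolding w_def using z x K_nonneg finite_Y by (intro member_le_sum) auto
  then show ?thesis using z \<kappa>_pos by simp
qed

lemma ip_add_left [simp]: "ip (\<lambda>x. u x + v x) z = ip u z + ip v z"
  by (simp add: ip_def algebra_simps sum.distrib)

lemma ip_scale_left [simp]: "ip (\<lambda>x. t * u x) z = t * ip u z"
  by (simp add: ip_def sum_distrib_left algebra_simps)

lemma ip_commute: "ip u v = ip v u"
  by (simp add: ip_def mult.commute)

lemma ip_add_right [simp]: "ip z (\<lambda>x. u x + v x) = ip z u + ip z v"
  by (simp add: ip_commute[of z])

lemma ip_scale_right [simp]: "ip z (\<lambda>x. t * u x) = t * ip z u"
  by (simp add: ip_commute[of z])

lemma ip_nonneg: "0 \<le> ip u u"
  unfolding ip_def using w_pos by (intro sum_nonneg) (simp add: less_imp_le)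

lemma ip_self_eq_0D: "ip u u = 0 \<Longrightarrow> x \<in> Y \<Longrightarrow> u x = 0"
  using w_pos finite_Y unfolding ip_def
  by (subst (asm) sum_nonneg_eq_0_iff) (auto simp: less_imp_le less_le)

lemma B_add [simp]: "B (\<lambda>x. u x + v x) = (\<lambda>x. B u x + B v x)"
  by (simp add: B_def fun_eq_iff algebra_simps sum.distrib add_divide_distrib)

lemma B_scale [simp]: "B (\<lambda>x. t * u x) = (\<lambda>x. t * B u x)"
  by (simp add: B_def fun_eq_iff sum_distrib_left sum_distrib_right algebra_simps sum_divide_distrib)

lemma ip_B: "ip u (B v) = (\<Sum>x\<in>Y. \<Sum>y\<in>Y. K x y * (u x * v y))"
proof -
  have "w x * (u x * B v x) = (\<Sum>y\<in>Y. K x y * (u x * v y))" if "x \<in> Y" for x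
    using w_pos[OF that] by (simp add: B_def) (simp add: sum_distrib_left algebra_simps)
  then show ?thesis by (simp add: ip_def)
qed

lemma B_selfadjoint: "ip (B u) v = ip u (B v)"
proof -
  have "ip (B u) v = (\<Sum>x\<in>Y. \<Sum>y\<in>Y. K x y * (v x * u y))"
    by (simp add: ip_commute[of "B u"] ip_B)
  also have "\<dots> = (\<Sum>y\<in>Y. \<Sum>x\<in>Y. K x y * (v x * u y))" by (rule sum.swap)
  also have "\<dots> = (\<Sum>y\<in>Y. \<Sum>x\<in>Y. K y x * (u y * v x))"
    by (intro sum.cong refl) (simp add: K_sym mult.commute)
  finally show ?thesis by (simp add: ip_B)
qed

text \<open>Constants are fixed by \<open>B\<close>, so self-adjointness makes the mean-zero
  functions an invariant subspace.\<close>

lemma ip_one_B: "ip (\<lambda>_. 1) (B u) = ip (\<lambda>_. 1) u"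
proof -
  have "ip u (B (\<lambda>_. 1)) = ip u (\<lambda>_. 1)"
    unfolding ip_B by (simp add: ip_def w_def sum_distrib_right)
  then show ?thesis using B_selfadjoint ip_commute by metis
qed

lemma ip_self: "ip u u = (\<Sum>x\<in>Y. \<Sum>y\<in>Y. K x y * ((u x)\<^sup>2 + (u y)\<^sup>2)) / 2"
proof -
  have 1: "(\<Sum>x\<in>Y. \<Sum>y\<in>Y. K x y * (u x)\<^sup>2) = ip u u"
    by (simp add: ip_def w_def sum_distrib_right power2_eq_square)
  have "(\<Sum>x\<in>Y. \<Sum>y\<in>Y. K x y * (u y)\<^sup>2) = (\<Sum>y\<in>Y. \<Sum>x\<in>Y. K x y * (u y)\<^sup>2)"
    by (rule sum.swap)
  also have "\<dots> = ip u u"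
    unfolding 1[symmetric] by (intro sum.cong refl) (simp add: K_sym)
  finally show ?thesis using 1 by (simp add: algebra_simps sum.distrib)
qed

lemma ip_add_B: "ip u u + ip u (B u) = (\<Sum>x\<in>Y. \<Sum>y\<in>Y. K x y * (u x + u y)\<^sup>2) / 2"
  unfolding ip_self ip_B sum_divide_distrib sum.distrib[symmetric]
  by (intro sum.cong refl) (simp add: power2_eq_square field_simps)

lemma ip_diff_B: "ip u u - ip u (B u) = (\<Sum>x\<in>Y. \<Sum>y\<in>Y. K x y * (u x - u y)\<^sup>2) / 2"
  unfolding ip_self ip_B sum_divide_distrib sum_subtractf[symmetric]
  by (intro sum.cong refl) (simp add: power2_eq_square field_simps)

lemma B_ge: "- ip u u \<le> ip u (B u)"
proof -
  have "0 \<le> ip u u + ip u (B u)"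
    unfolding ip_add_B using K_nonneg by (intro divide_nonneg_nonneg sum_nonneg) auto
  then show ?thesis by simp
qed

section \<open>Spectral gap, and nonpositivity on mean-zero functions\<close>

text \<open>One edge of weight at least \<kappa> costs at most twice the Dirichlet form. Splitting a
  difference along a path of two edges doubles each square, hence 8 = 2 * 2 + 2 * 2.\<close>

lemma Dirichlet_ge:
  assumes x: "x \<in> Y" and y: "y \<in> Y"
  shows "\<kappa> * (u x - u y)\<^sup>2 \<le> 8 * (ip u u - ip u (B u))"
proof -
  let ?D = "ip u u - ip u (B u)"
  have edge: "\<kappa> * (u a - u b)\<^sup>2 \<le> 2 * ?D" if "a \<in> Y" "b \<in> Y" "\<kappa> \<le> K a b" for a b
  proof -
    have "\<kappa> * (u a - u b)\<^sup>2 \<le> K a b * (u a - u b)\<^sup>2" using that by (intro mult_right_mono) auto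
    also have "\<dots> \<le> (\<Sum>y\<in>Y. K a y * (u a - u y)\<^sup>2)"
      using that K_nonneg finite_Y
      by (intro member_le_sum[where f = "\<lambda>y. K a y * (u a - u y)\<^sup>2"]) auto
    also have "\<dots> \<le> (\<Sum>x\<in>Y. \<Sum>y\<in>Y. K x y * (u x - u y)\<^sup>2)"
      using that K_nonneg finite_Y
      by (intro member_le_sum[where f = "\<lambda>x. \<Sum>y\<in>Y. K x y * (u x - u y)\<^sup>2"] sum_nonneg) auto
    finally show ?thesis by (simp add: ip_diff_B)
  qed
  have D: "0 \<le> ?D" unfolding ip_diff_B using K_nonneg by (intro divide_nonneg_nonneg sum_nonneg) auto
  from two_steps[OF x y] show ?thesis
  proof (elim disjE bexE conjE)
    assume "\<kappa> \<le> K x y"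
    then show ?thesis using edge[OF x y] D by simp
  next
    fix z assume z: "z \<in> Y" "\<kappa> \<le> K x z" "\<kappa> \<le> K z y"
    have sq: "(u x - u y)\<^sup>2 \<le> 2 * (u x - u z)\<^sup>2 + 2 * (u z - u y)\<^sup>2"
      using zero_le_power2[of "(u x - u z) - (u z - u y)"]
      by (simp add: power2_eq_square algebra_simps)
    have "\<kappa> * (u x - u y)\<^sup>2 \<le> \<kappa> * (2 * (u x - u z)\<^sup>2 + 2 * (u z - u y)\<^sup>2)"
      using \<kappa>_pos sq by (intro mult_left_mono) auto
    also have "\<dots> = 2 * (\<kappa> * (u x - u z)\<^sup>2) + 2 * (\<kappa> * (u z - u y)\<^sup>2)" by (simp add: algebra_simps)
    also have "\<dots> \<le> 8 * ?D" using edge[of x z] edge[of z y] x y z by simp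
    finally show ?thesis .
  qed
qed

text \<open>A Poincare inequality: \<open>Dirichlet_ge\<close> is averaged over all pairs with
  weights \<open>w x * w y\<close>. For mean-zero \<open>u\<close> the cross terms vanish and the
  left side becomes a multiple of \<open>ip u u\<close>.\<close>

lemma spectral_gap:
  obtains \<delta> where "0 < \<delta>" "\<delta> \<le> 1"
    "\<And>u. ip (\<lambda>_. 1) u = 0 \<Longrightarrow> ip u (B u) \<le> (1 - \<delta>) * ip u u"
proof (cases "Y = {}")
  case True
  have "ip u v = 0" for u v unfolding ip_def by (simp add: True)
  then show ?thesis by (intro that[of 1]) simp_all
next
  case False
  define W where "W = sum w Y"
  have W: "W > 0" unfolding W_def using False finite_Y w_pos by (intro sum_pos) auto
  define \<epsilon> where "\<epsilon> = \<kappa> / (4 * W)"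
  have \<epsilon>: "\<epsilon> > 0" using W \<kappa>_pos by (simp add: \<epsilon>_def)
  show ?thesis
  \<comment> \<open>Capping at 1 keeps \<open>1 - \<delta>\<close> nonnegative, as the iteration in
    \<open>B_nonpos\<close> requires.\<close>
  proof (rule that[of "min 1 \<epsilon>"])
    show "0 < min 1 \<epsilon>" "min 1 \<epsilon> \<le> 1" using \<epsilon> by auto
    fix u assume u: "ip (\<lambda>_. 1) u = 0"
    let ?D = "ip u u - ip u (B u)"
    have m: "(\<Sum>y\<in>Y. w y * u y) = 0" using u by (simp add: ip_def)
    have "(\<Sum>x\<in>Y. \<Sum>y\<in>Y. w x * w y * (u x - u y)\<^sup>2)
        = (\<Sum>x\<in>Y. w x * (u x)\<^sup>2 * W - 2 * (w x * u x) * (\<Sum>y\<in>Y. w y * u y) + w x * ip u u)"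
      unfolding W_def ip_def sum_distrib_left sum.distrib[symmetric] sum_subtractf[symmetric]
      by (intro sum.cong refl) (simp add: power2_eq_square algebra_simps)
    also have "\<dots> = 2 * W * ip u u"
      unfolding m by (simp add: sum.distrib sum_distrib_right[symmetric] W_def[symmetric])
        (simp add: ip_def power2_eq_square)
    finally have eq: "2 * W * ip u u = (\<Sum>x\<in>Y. \<Sum>y\<in>Y. w x * w y * (u x - u y)\<^sup>2)" by simp
    have "\<kappa> * (2 * W * ip u u) = (\<Sum>x\<in>Y. \<Sum>y\<in>Y. w x * w y * (\<kappa> * (u x - u y)\<^sup>2))"
      unfolding eq sum_distrib_left by (intro sum.cong refl) simp
    also have "\<dots> \<le> (\<Sum>x\<in>Y. \<Sum>y\<in>Y. w x * w y * (8 * ?D))"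
      using w_pos Dirichlet_ge by (intro sum_mono mult_left_mono) (auto simp: less_imp_le)
    also have "\<dots> = W * (W * (8 * ?D))"
      unfolding W_def mult.assoc sum_distrib_left[symmetric] sum_distrib_right[symmetric] ..
    finally have "W * (\<kappa> * ip u u) \<le> W * (4 * W * ?D)" by (simp add: algebra_simps)
    then have "\<kappa> * ip u u \<le> 4 * W * ?D" using W by simp
    then have "\<epsilon> * ip u u \<le> ?D" using W by (simp add: \<epsilon>_def field_simps)
    moreover have "min 1 \<epsilon> * ip u u \<le> \<epsilon> * ip u u" by (intro mult_right_mono ip_nonneg) auto
    ultimately show "ip u (B u) \<le> (1 - min 1 \<epsilon>) * ip u u" by (simp add: algebra_simps)
  qed
qed

text \<open>For \<open>M = \<mu> - B\<close>, which is positive semidefinite and at most \<open>1 + \<mu>\<close>, this is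
  \<open>M\<^sup>2 \<le> (1 + \<mu>) M\<close>.\<close>

lemma B_norm_le:
  assumes lam: "0 \<le> \<mu>"
    and bound: "\<And>v. ip (\<lambda>_. 1) v = 0 \<Longrightarrow> ip v (B v) \<le> \<mu> * ip v v"
    and u: "ip (\<lambda>_. 1) u = 0"
  shows "ip (B u) (B u) \<le> \<mu> * ip u u + (\<mu> - 1) * ip u (B u)"
proof -
  define z where "z = (\<lambda>x. \<mu> * u x + (-1) * B u x)"
  have z0: "ip (\<lambda>_. 1) z = 0"
    unfolding z_def ip_add_right ip_scale_right ip_one_B u by simp
  have zz: "ip z z = \<mu>\<^sup>2 * ip u u - 2 * \<mu> * ip u (B u) + ip (B u) (B u)"
    unfolding z_def ip_add_left ip_scale_left ip_add_right ip_scale_right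
    by (simp add: ip_commute[of "B u" u] power2_eq_square algebra_simps)
  have zMu: "ip u (\<lambda>x. \<mu> * z x + (-1) * B z x) = ip z z"
  proof -
    have "ip u (\<lambda>x. \<mu> * z x + (-1) * B z x) = \<mu> * ip u z - ip (B u) z"
      by (simp only: ip_add_right ip_scale_right B_selfadjoint)
    also have "\<dots> = ip (\<lambda>x. \<mu> * u x + (-1) * B u x) z"
      by (simp only: ip_add_left ip_scale_left)
    also have "\<dots> = ip z z" by (simp only: z_def)
    finally show ?thesis .
  qed
  \<comment> \<open>Here \<open>z\<close> is \<open>M u\<close>. This \<open>t\<close> minimizes
    \<open>2 * t + t\<^sup>2 * (1 + \<mu>)\<close>, the factor of \<open>ip z z\<close> in the upper
    bound for the form of \<open>M\<close> at \<open>u + t z\<close>.\<close>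
  define t where "t = - 1 / (1 + \<mu>)"
  let ?v = "\<lambda>x. u x + t * z x"
  have v: "ip (\<lambda>_. 1) ?v = 0" using u z0 by simp
  have c: "\<mu> * ip u z - ip u (B z) = ip z z" using zMu by (simp only: ip_add_right ip_scale_right)
  have "ip z (B u) = ip u (B z)" by (metis B_selfadjoint ip_commute)
  then have "\<mu> * ip ?v ?v - ip ?v (B ?v) = \<mu> * ip u u - ip u (B u)
      + 2 * t * (\<mu> * ip u z - ip u (B z)) + t\<^sup>2 * (\<mu> * ip z z - ip z (B z))"
    by (simp add: ip_commute[of z u] power2_eq_square algebra_simps)
  then have "0 \<le> \<mu> * ip u u - ip u (B u) + 2 * t * ip z z + t\<^sup>2 * (\<mu> * ip z z - ip z (B z))"
    using bound[OF v] c by simp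
  also have "\<dots> \<le> \<mu> * ip u u - ip u (B u) + 2 * t * ip z z + t\<^sup>2 * ((1 + \<mu>) * ip z z)"
    using B_ge[of z] by (intro add_left_mono mult_left_mono) (auto simp: algebra_simps)
  also have "\<dots> = \<mu> * ip u u - ip u (B u) - ip z z / (1 + \<mu>)"
    using lam by (simp add: t_def power2_eq_square divide_simps)
  finally have "ip z z \<le> (1 + \<mu>) * (\<mu> * ip u u - ip u (B u))"
    using lam by (simp add: field_simps)
  then show ?thesis unfolding zz by (simp add: power2_eq_square algebra_simps)
qed

text \<open>An upper bound \<open>\<mu> < 1\<close> for \<open>B\<close> on the mean-zero functions improves to
  \<open>\<mu> / (2 - \<mu>)\<close>, because \<open>B \<le> B\<^sup>2\<close> excludes spectrum in \<open>(0, 1)\<close>.\<close>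

lemma B_nonpos:
  assumes idem: "\<And>u. ip u (B u) \<le> ip (B u) (B u)"
    and u: "ip (\<lambda>_. 1) u = 0"
  shows "ip u (B u) \<le> 0"
proof -
  obtain \<delta> where \<delta>: "0 < \<delta>" "\<delta> \<le> 1"
    and gap: "\<And>u. ip (\<lambda>_. 1) u = 0 \<Longrightarrow> ip u (B u) \<le> (1 - \<delta>) * ip u u"
    using spectral_gap by blast
  \<comment> \<open>As \<mu> stays at most \<open>1 - \<delta>\<close>, the improved bound
    \<open>\<mu> / (2 - \<mu>)\<close> is at most \<open>\<rho> * \<mu>\<close>: every round
    contracts by this factor.\<close>
  define \<rho> where "\<rho> = 1 / (1 + \<delta>)"
  have \<rho>: "0 < \<rho>" "\<rho> < 1" using \<delta> by (auto simp: \<rho>_def)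
  have iter: "ip u (B u) \<le> ((1 - \<delta>) * \<rho> ^ n) * ip u u" if "ip (\<lambda>_. 1) u = 0" for n u
    using that
  proof (induction n arbitrary: u)
    case 0
    then show ?case using gap by simp
  next
    case (Suc n)
    define \<mu> where "\<mu> = (1 - \<delta>) * \<rho> ^ n"
    have \<mu>0: "0 \<le> \<mu>" using \<delta> \<rho> by (simp add: \<mu>_def)
    have "\<rho> ^ n \<le> 1" using \<rho> by (simp add: power_le_one)
    then have "\<mu> \<le> (1 - \<delta>) * 1" unfolding \<mu>_def using \<delta> by (intro mult_left_mono) auto
    then have \<mu>1: "\<mu> \<le> 1 - \<delta>" by simp
    have "ip (B u) (B u) \<le> \<mu> * ip u u + (\<mu> - 1) * ip u (B u)"
      using Suc.IH Suc.prems \<mu>0 unfolding \<mu>_def by (intro B_norm_le) auto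
    then have "(2 - \<mu>) * ip u (B u) \<le> \<mu> * ip u u" using idem[of u] by (simp add: algebra_simps)
    then have "ip u (B u) \<le> \<mu> / (2 - \<mu>) * ip u u" using \<mu>1 \<delta> by (simp add: field_simps)
    also have "\<mu> / (2 - \<mu>) \<le> \<mu> / (1 + \<delta>)"
      using \<mu>0 \<mu>1 \<delta> by (intro divide_left_mono mult_pos_pos) auto
    then have "\<mu> / (2 - \<mu>) * ip u u \<le> \<mu> / (1 + \<delta>) * ip u u" by (intro mult_right_mono ip_nonneg)
    also have "\<mu> / (1 + \<delta>) = (1 - \<delta>) * \<rho> ^ Suc n" by (simp add: \<mu>_def \<rho>_def)
    finally show ?case .
  qed
  have "(\<lambda>n. ((1 - \<delta>) * \<rho> ^ n) * ip u u) \<longlonglongrightarrow> ((1 - \<delta>) * 0) * ip u u"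
    using \<rho> by (intro tendsto_intros LIMSEQ_power_zero) auto
  then show ?thesis
    using iter[OF u] by (intro LIMSEQ_le_const) auto
qed

section \<open>Gradient ascent with one extra coordinate\<close>

text \<open>Half the gradient of \<open>quad_form\<close> in the variable \<open>g\<close>, taken
  with respect to \<open>ip\<close>.\<close>

definition aff :: "('a \<Rightarrow> real) \<Rightarrow> ('a \<Rightarrow> real) \<Rightarrow> real \<Rightarrow> 'a \<Rightarrow> real"
  where "aff c g \<tau> x = B g x + \<tau> * c x"

definition quad_form :: "('a \<Rightarrow> real) \<Rightarrow> real \<Rightarrow> ('a \<Rightarrow> real) \<Rightarrow> real \<Rightarrow> real"
  where "quad_form c \<beta> g \<tau> = ip g (B g) + 2 * \<tau> * ip c g + \<beta> * \<tau>\<^sup>2"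

context
  fixes c :: "'a \<Rightarrow> real" and \<beta> :: real
  assumes quad_le: "\<And>g \<tau>. quad_form c \<beta> g \<tau> \<le> ip (aff c g \<tau>) (aff c g \<tau>)"
begin

text \<open>At \<open>\<tau> = 0\<close> the assumption \<open>quad_le\<close> is exactly the
  inequality between \<open>B\<close> and its square that \<open>B_nonpos\<close> asks for.\<close>

lemma B_nonpos_aff:
  assumes "ip (\<lambda>_. 1) u = 0"
  shows "ip u (B u) \<le> 0"
  using quad_le[of _ 0] assms by (intro B_nonpos) (simp_all add: aff_def[abs_def] quad_form_def)

text \<open>Moving \<open>g\<close> by \<open>r\<close> raises the form by
  \<open>2 * ip r r + ip r (B r)\<close>, and \<open>B\<close> is at least -1. The new gradient is
  \<open>r + B r\<close>, which is no longer than \<open>r\<close> because \<open>B\<close> lies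
  between -1 and 0 on mean-zero functions.\<close>

lemma ascent:
  fixes g :: "'a \<Rightarrow> real"
  assumes "ip (\<lambda>_. 1) (aff c g \<tau>) = 0"
  defines "r \<equiv> aff c g \<tau>" and "g' \<equiv> \<lambda>x. g x + aff c g \<tau> x"
  shows "ip (\<lambda>_. 1) (aff c g' \<tau>) = 0"
    and "quad_form c \<beta> g \<tau> + ip r r \<le> quad_form c \<beta> g' \<tau>"
    and "ip (aff c g' \<tau>) (aff c g' \<tau>) \<le> ip r r"
proof -
  have r0: "ip (\<lambda>_. 1) r = 0" using assms(1) by (simp add: r_def)
  have aff': "aff c g' \<tau> = (\<lambda>x. r x + B r x)"
    unfolding g'_def r_def[symmetric] by (simp add: aff_def fun_eq_iff) (simp add: r_def aff_def)
  show "ip (\<lambda>_. 1) (aff c g' \<tau>) = 0" unfolding aff' by (simp add: r0 ip_one_B)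
  have "ip r r = ip r (\<lambda>x. B g x + \<tau> * c x)" by (simp add: r_def aff_def[abs_def])
  also have "\<dots> = ip r (B g) + \<tau> * ip c r" by (simp add: ip_commute)
  finally have rr: "ip r r = ip r (B g) + \<tau> * ip c r" .
  have "ip g (B r) = ip r (B g)" by (metis B_selfadjoint ip_commute)
  then have "quad_form c \<beta> g' \<tau> = quad_form c \<beta> g \<tau> + 2 * ip r r + ip r (B r)"
    unfolding g'_def r_def[symmetric] by (simp add: quad_form_def rr algebra_simps)
  then show "quad_form c \<beta> g \<tau> + ip r r \<le> quad_form c \<beta> g' \<tau>" using B_ge[of r] by simp
  \<comment> \<open>The case \<open>\<mu> = 0\<close> of \<open>B_norm_le\<close>, available since
    \<open>B\<close> is already known to be nonpositive here.\<close>
  have "ip (B r) (B r) \<le> 0 * ip r r + (0 - 1) * ip r (B r)"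
    using B_nonpos_aff r0 by (intro B_norm_le) auto
  then show "ip (aff c g' \<tau>) (aff c g' \<tau>) \<le> ip r r"
    unfolding aff' using B_nonpos_aff[OF r0] by (simp add: ip_commute[of "B r" r])
qed

text \<open>By \<open>quad_le\<close> the gain \<open>ip r r\<close> is at least the current value,
  so each ascent step doubles a positive value. Yet all values stay below the squared gradient norm,
  which never grows.\<close>

lemma quad_form_nonpos:
  assumes "ip (\<lambda>_. 1) (aff c g \<tau>) = 0"
  shows "quad_form c \<beta> g \<tau> \<le> 0"
proof (rule ccontr)
  assume "\<not> quad_form c \<beta> g \<tau> \<le> 0"
  then have pos: "quad_form c \<beta> g \<tau> > 0" by simp
  let ?R = "ip (aff c g \<tau>) (aff c g \<tau>)"
  have iter: "\<exists>g'. ip (\<lambda>_. 1) (aff c g' \<tau>) = 0 \<and> 2 ^ n * quad_form c \<beta> g \<tau> \<le> quad_form c \<beta> g' \<tau>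
     \<and> ip (aff c g' \<tau>) (aff c g' \<tau>) \<le> ?R" for n
  proof (induction n)
    case 0
    then show ?case using assms by auto
  next
    case (Suc n)
    then obtain g' where g': "ip (\<lambda>_. 1) (aff c g' \<tau>) = 0"
      "2 ^ n * quad_form c \<beta> g \<tau> \<le> quad_form c \<beta> g' \<tau>"
      "ip (aff c g' \<tau>) (aff c g' \<tau>) \<le> ?R" by blast
    show ?case
      using ascent[OF g'(1)] quad_le[of g' \<tau>] g'
      by (intro exI[of _ "\<lambda>x. g' x + aff c g' \<tau> x"]) auto
  qed
  obtain n where n: "?R / quad_form c \<beta> g \<tau> < 2 ^ n"
    using real_arch_pow[of 2] by auto
  obtain g' where "2 ^ n * quad_form c \<beta> g \<tau> \<le> quad_form c \<beta> g' \<tau>"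
     "ip (aff c g' \<tau>) (aff c g' \<tau>) \<le> ?R" using iter by blast
  then have "2 ^ n * quad_form c \<beta> g \<tau> \<le> ?R" using quad_le[of g' \<tau>] by simp
  then show False using n pos by (simp add: field_simps)
qed

text \<open>One ascent step from value 0 must not produce a positive value, so its gain, the squared
  gradient norm, vanishes.\<close>

lemma aff_eq_0:
  assumes "ip (\<lambda>_. 1) (aff c g \<tau>) = 0" and "quad_form c \<beta> g \<tau> = 0" and "x \<in> Y"
  shows "aff c g \<tau> x = 0"
proof -
  have "ip (aff c g \<tau>) (aff c g \<tau>) \<le> 0"
    using ascent[OF assms(1)] quad_form_nonpos assms(2) by force
  then show ?thesis using ip_nonneg ip_self_eq_0D assms(3) by (metis order_antisym)
qed

end

end

section \<open>The form of a weighted complete multipartite graph\<close>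

text \<open>With \<open>q = card P\<close>, \<open>t C = s C / sum s P\<close>, \<open>a = \<Sum> t m\<close> and \<open>b = \<Sum> (1 - t) m\<close>, the negated form
  at the largest \<open>\<beta>\<close> exceeds
  \<open>\<Sum> (m - a t - b (1 - t) / (q - 1))\<^sup>2\<close> by \<open>(1 - \<Sum> t\<^sup>2) (a - b / (q - 1))\<^sup>2\<close>.\<close>

lemma multipartite_form_nonpos:
  fixes s m :: "'c \<Rightarrow> real"
  assumes fin: "finite P" and card: "2 \<le> card P" and s: "\<And>C. C \<in> P \<Longrightarrow> 0 < s C"
    and \<beta>: "\<beta> \<le> 1 + 1 / (real (card P) - 1)"
    and lin: "(\<Sum>C\<in>P. s C * (sum m P - m C)) + \<tau> * sum s P = 0"
  shows "(\<Sum>C\<in>P. m C * (sum m P - m C)) + 2 * \<tau> * sum m P + \<beta> * \<tau>\<^sup>2 \<le> 0"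
proof -
  have ne: "P \<noteq> {}" using card by auto
  define \<sigma> where "\<sigma> = sum s P"
  define t where "t C = s C / \<sigma>" for C
  define r where "r = real (card P) - 1"
  have r: "0 < r" using card by (simp add: r_def)
  have \<sigma>: "0 < \<sigma>" unfolding \<sigma>_def using fin ne s by (intro sum_pos) auto
  define T where "T = (\<Sum>C\<in>P. (t C)\<^sup>2)"
  define a where "a = (\<Sum>C\<in>P. t C * m C)"
  define b where "b = (\<Sum>C\<in>P. (1 - t C) * m C)"
  define Q where "Q = (\<Sum>C\<in>P. (m C)\<^sup>2)"
  have t1: "sum t P = 1" using \<sigma> by (simp add: t_def sum_divide_distrib[symmetric] \<sigma>_def)
  have t_bounds: "0 \<le> t C" "t C \<le> 1" if "C \<in> P" for C
  proof -
    have "s C \<le> \<sigma>" unfolding \<sigma>_def using fin that s by (intro member_le_sum) (auto simp: less_imp_le)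
    then show "0 \<le> t C" "t C \<le> 1" using \<sigma> s[OF that] by (auto simp: t_def)
  qed
  have "T \<le> sum t P"
    unfolding T_def power2_eq_square using t_bounds by (intro sum_mono) (simp add: mult_left_le)
  then have T: "T \<le> 1" using t1 by simp
  have ab: "a + b = sum m P" unfolding a_def b_def by (simp add: algebra_simps sum_subtractf)
  have "(\<Sum>C\<in>P. s C * m C) = \<sigma> * a" using \<sigma> by (simp add: a_def t_def sum_distrib_left)
  moreover have "(\<Sum>C\<in>P. s C * (sum m P - m C)) = \<sigma> * sum m P - (\<Sum>C\<in>P. s C * m C)"
    by (simp add: right_diff_distrib sum_subtractf \<sigma>_def sum_distrib_right)
  ultimately have "\<sigma> * (sum m P + \<tau> - a) = 0" using lin by (simp add: \<sigma>_def[symmetric] algebra_simps)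
  \<comment> \<open>The constraint \<open>lin\<close> thus eliminates \<tau>; what remains is a
    quadratic form in \<open>m\<close> alone.\<close>
  then have \<tau>: "\<tau> = - b" using \<sigma> ab by simp
  define \<gamma> where "\<gamma> = b / r"
  have "0 \<le> (\<Sum>C\<in>P. (m C - a * t C - \<gamma> * (1 - t C))\<^sup>2)" by (intro sum_nonneg) simp
  also have "\<dots> = (\<Sum>C\<in>P. (m C)\<^sup>2 - 2 * a * (t C * m C) - 2 * \<gamma> * ((1 - t C) * m C)
      + a\<^sup>2 * (t C)\<^sup>2 + 2 * a * \<gamma> * (t C - (t C)\<^sup>2) + \<gamma>\<^sup>2 * (1 - 2 * t C + (t C)\<^sup>2))"
    by (intro sum.cong refl) (simp add: power2_eq_square algebra_simps)
  also have "\<dots> = Q - 2 * a * a - 2 * \<gamma> * b + a\<^sup>2 * T + 2 * a * \<gamma> * (1 - T) + \<gamma>\<^sup>2 * (r - 1 + T)"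
    by (simp add: sum.distrib sum_subtractf sum_distrib_left[symmetric] t1
        Q_def[symmetric] a_def[symmetric] b_def[symmetric] T_def[symmetric]) (simp add: r_def)
  also have "\<dots> = Q - a\<^sup>2 - b\<^sup>2 / r - (1 - T) * (a - b / r)\<^sup>2"
    unfolding \<gamma>_def using r by (simp add: field_simps power2_eq_square)
  also have "\<dots> \<le> Q - a\<^sup>2 - b\<^sup>2 / r" using T by simp
  finally have "a\<^sup>2 + b\<^sup>2 / r \<le> Q" by simp
  moreover have "\<beta> * \<tau>\<^sup>2 \<le> (1 + 1 / r) * \<tau>\<^sup>2" using \<beta> by (intro mult_right_mono) (auto simp: r_def)
  moreover have "(\<Sum>C\<in>P. m C * (sum m P - m C)) = (a + b)\<^sup>2 - Q"
    by (simp add: right_diff_distrib sum_subtractf sum_distrib_right[symmetric] ab Q_def power2_eq_square)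
  ultimately have "(\<Sum>C\<in>P. m C * (sum m P - m C)) + 2 * \<tau> * sum m P + \<beta> * \<tau>\<^sup>2
      \<le> (a + b)\<^sup>2 - (a\<^sup>2 + b\<^sup>2 / r) + 2 * \<tau> * (a + b) + (1 + 1 / r) * \<tau>\<^sup>2"
    by (simp add: ab)
  also have "\<dots> = 0" unfolding \<tau> by (simp add: power2_eq_square algebra_simps)
  finally show ?thesis .
qed

text \<open>\<open>lin\<close> and \<open>quad\<close> express that (-c, 1) is orthogonal to (1, 0)
  and null. They fix the sum and the sum of squares of \<open>s\<close>, so the squared deviation
  from \<open>\<sigma> / p\<close> is a positive multiple of \<open>card P - p\<close>. It is
  nonnegative while \<open>card P \<le> p\<close>, so both vanish.\<close>

lemma multipartite_form_equality:
  fixes s :: "'c \<Rightarrow> real"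
  assumes fin: "finite P" and p: "card P \<le> p" "2 \<le> p" and c: "c \<noteq> 0"
    and lin: "c * (\<Sum>C\<in>P. s C * (sum s P - s C)) = sum s P"
    and quad: "c * sum s P = 1 + 1 / (real p - 1)"
  shows "card P = p" and "C \<in> P \<Longrightarrow> s C = (1 + 1 / (real p - 1)) / (c * real p)"
proof -
  define \<sigma> where "\<sigma> = sum s P"
  have p': "0 < real p - 1" using p by simp
  have \<sigma>c: "c * \<sigma> = real p / (real p - 1)" using quad p' by (simp add: \<sigma>_def field_simps)
  have \<sigma>: "\<sigma> \<noteq> 0" using \<sigma>c p by auto
  have "(\<Sum>C\<in>P. s C * (sum s P - s C)) = \<sigma>\<^sup>2 - (\<Sum>C\<in>P. (s C)\<^sup>2)"
    by (simp add: right_diff_distrib sum_subtractf sum_distrib_right[symmetric] \<sigma>_def power2_eq_square)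
  then have "c * (\<sigma>\<^sup>2 - (\<Sum>C\<in>P. (s C)\<^sup>2)) = \<sigma>" using lin by (simp add: \<sigma>_def)
  then have "(c * \<sigma>) * (\<sigma>\<^sup>2 - (\<Sum>C\<in>P. (s C)\<^sup>2)) = \<sigma>\<^sup>2" by (simp add: power2_eq_square algebra_simps)
  then have sq: "(\<Sum>C\<in>P. (s C)\<^sup>2) = \<sigma>\<^sup>2 / real p"
    unfolding \<sigma>c using p' p by (simp add: field_simps)
  have "(\<Sum>C\<in>P. (s C - \<sigma> / p)\<^sup>2) = (\<Sum>C\<in>P. (s C)\<^sup>2 - 2 * (\<sigma> / p) * s C + (\<sigma> / p)\<^sup>2)"
    by (intro sum.cong refl) (simp add: power2_eq_square algebra_simps)
  also have "\<dots> = \<sigma>\<^sup>2 / p - 2 * (\<sigma> / p) * \<sigma> + card P * (\<sigma> / p)\<^sup>2"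
    by (simp add: sum.distrib sum_subtractf sum_distrib_left[symmetric]
        sum_divide_distrib[symmetric] sq \<sigma>_def[symmetric])
  also have "\<dots> = (\<sigma> / p)\<^sup>2 * (real (card P) - real p)"
    using p by (simp add: field_simps power2_eq_square)
  finally have eq: "(\<Sum>C\<in>P. (s C - \<sigma> / p)\<^sup>2) = (\<sigma> / p)\<^sup>2 * (real (card P) - real p)" .
  have "0 \<le> (\<Sum>C\<in>P. (s C - \<sigma> / p)\<^sup>2)" by (intro sum_nonneg) simp
  moreover have "0 < (\<sigma> / p)\<^sup>2" using \<sigma> p by simp
  ultimately have "real p \<le> real (card P)" unfolding eq by (simp add: zero_le_mult_iff)
  then show card: "card P = p" using p by simp
  have "s C - \<sigma> / p = 0" if "C \<in> P" for C
    using eq fin that unfolding card by (simp add: sum_nonneg_eq_0_iff)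
  moreover have "\<sigma> / p = (1 + 1 / (real p - 1)) / (c * real p)"
    unfolding quad[symmetric] \<sigma>_def using c by simp
  ultimately show "s C = (1 + 1 / (real p - 1)) / (c * real p)" if "C \<in> P" using that by force
qed

section \<open>Ordered extension sums in a matroid\<close>

locale weighted_matroid = matroid X I for X :: "'a set" and I :: "'a set set" +
  fixes \<omega> :: "'a \<Rightarrow> real"
  assumes weight_pos: "x \<in> X \<Longrightarrow> 0 < \<omega> x"
begin

lemma finite_indep: "S \<in> I \<Longrightarrow> finite S"
  using finite_ground indep_subset_ground finite_subset by blast

lemma finite_I: "finite I"
  using finite_ground indep_subset_ground by (meson PowI finite_Pow_iff finite_subset subsetI)

lemma in_Cont_iff: "x \<in> Cont X I S \<longleftrightarrow> x \<in> X \<and> x \<notin> S \<and> insert x S \<in> I"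
  by (auto simp: Cont_def)

lemma finite_Cont [simp]: "finite (Cont X I S)"
  using finite_ground by (simp add: Cont_def)

lemma Cont_weight_pos: "x \<in> Cont X I S \<Longrightarrow> 0 < \<omega> x"
  using weight_pos by (simp add: in_Cont_iff)

text \<open>Both sides say that \<open>x\<close> and \<open>y\<close> are distinct elements outside
  \<open>S\<close> which together extend \<open>S\<close> to an independent set.\<close>

lemma Cont_insert_swap:
  "x \<in> Cont X I S \<and> y \<in> Cont X I (insert x S) \<longleftrightarrow> y \<in> Cont X I S \<and> x \<in> Cont X I (insert y S)"
  using indep_subset[of "insert x (insert y S)" "insert x S"]
    indep_subset[of "insert x (insert y S)" "insert y S"]
  by (auto simp: in_Cont_iff insert_commute)

lemma Cont_insert_iff:
  assumes "x \<in> Cont X I S"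
  shows "y \<in> Cont X I (insert x S) \<longleftrightarrow> y \<in> Cont X I S \<and> (x, y) \<notin> parallel X I S"
proof (cases "y \<in> Cont X I S")
  case True
  then show ?thesis using assms by (auto simp: parallel_def in_Cont_iff insert_commute)
next
  case False
  then show ?thesis using Cont_insert_swap[of x S y] assms by simp
qed

lemma sum_Cont_swap:
  "(\<Sum>x\<in>Cont X I S. \<Sum>y\<in>Cont X I (insert x S). f x y)
    = (\<Sum>y\<in>Cont X I S. \<Sum>x\<in>Cont X I (insert y S). f x y)"
  by (simp add: sum.Sigma)
    (rule sum.reindex_bij_witness[of _ prod.swap prod.swap], use Cont_insert_swap in auto)

lemma Cont_nonempty:
  assumes "S \<in> I" "card S < rk I"
  obtains x where "x \<in> Cont X I S"
proof -
  have "rk I \<in> card ` I"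
    unfolding rk_def using finite_I indep_empty by (intro Max_in) auto
  then obtain T where T: "T \<in> I" "card T = rk I" by auto
  then obtain x where "x \<in> T - S" "insert x S \<in> I" using augmentation assms by metis
  then show ?thesis using that indep_subset_ground[OF T(1)] by (auto simp: in_Cont_iff)
qed

text \<open>The weighted sum of \<open>f\<close> over the ends of all ordered \<open>n\<close>-step
  extensions of \<open>S\<close>. With orderings kept, either the first or the last added element
  can be split off.\<close>

primrec ext_sum :: "nat \<Rightarrow> ('a set \<Rightarrow> real) \<Rightarrow> 'a set \<Rightarrow> real" where
  "ext_sum 0 f S = f S"
| "ext_sum (Suc n) f S = (\<Sum>x\<in>Cont X I S. \<omega> x * ext_sum n f (insert x S))"

abbreviation ext_count :: "nat \<Rightarrow> 'a set \<Rightarrow> real"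
  where "ext_count n \<equiv> ext_sum n (\<lambda>_. 1)"

lemma ext_sum_add: "ext_sum n (\<lambda>T. f T + h T) S = ext_sum n f S + ext_sum n h S"
  by (induction n arbitrary: S) (simp_all add: algebra_simps sum.distrib)

lemma ext_sum_scale: "ext_sum n (\<lambda>T. a * f T) S = a * ext_sum n f S"
  by (induction n arbitrary: S) (simp_all add: algebra_simps sum_distrib_left)

text \<open>The element added last is moved to the front by repeated exchange of neighbours in the
  ordering. This turns sums of local forms into matrices with \<open>ext_count\<close>
  entries.\<close>

lemma ext_sum_Cont:
  "ext_sum n (\<lambda>T. \<Sum>x\<in>Cont X I T. \<omega> x * F x (insert x T)) S
    = (\<Sum>x\<in>Cont X I S. \<omega> x * ext_sum n (F x) (insert x S))"
proof (induction n arbitrary: S)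
  case (Suc n)
  have "ext_sum (Suc n) (\<lambda>T. \<Sum>x\<in>Cont X I T. \<omega> x * F x (insert x T)) S
      = (\<Sum>z\<in>Cont X I S. \<Sum>x\<in>Cont X I (insert z S). \<omega> z * (\<omega> x * ext_sum n (F x) (insert x (insert z S))))"
    by (simp add: Suc sum_distrib_left)
  also have "\<dots> = (\<Sum>x\<in>Cont X I S. \<Sum>z\<in>Cont X I (insert x S). \<omega> z * (\<omega> x * ext_sum n (F x) (insert x (insert z S))))"
    by (rule sum_Cont_swap)
  also have "\<dots> = (\<Sum>x\<in>Cont X I S. \<omega> x * ext_sum (Suc n) (F x) (insert x S))"
    by (simp add: sum_distrib_left insert_commute mult.left_commute)
  finally show ?case .
qed simp

lemma ext_sum_Suc_right:
  "ext_sum (Suc n) f S = ext_sum n (\<lambda>T. \<Sum>x\<in>Cont X I T. \<omega> x * f (insert x T)) S"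
  using ext_sum_Cont[of n "\<lambda>_. f" S] by simp

lemma ext_count_pos: "T \<in> I \<Longrightarrow> card T + n \<le> rk I \<Longrightarrow> 0 < ext_count n T"
proof (induction n arbitrary: T)
  case (Suc n)
  obtain x where x: "x \<in> Cont X I T" using Cont_nonempty[OF Suc.prems(1)] Suc.prems(2) by auto
  have "0 < \<omega> x * ext_count n (insert x T)" if "x \<in> Cont X I T" for x
    using that Suc Cont_weight_pos by (intro mult_pos_pos Suc.IH) (auto simp: in_Cont_iff finite_indep)
  then show ?case using x by (auto intro!: sum_pos)
qed simp

text \<open>Every independent set of size \<open>n\<close> is reached by all of its
  \<open>fact n\<close> orderings.\<close>

lemma ext_sum_empty:
  "ext_sum n f {} = fact n * (\<Sum>S\<in>indep_size I n. (\<Prod>x\<in>S. \<omega> x) * f S)"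
proof (induction n arbitrary: f)
  case 0
  have "indep_size I 0 = {{}}" using indep_empty finite_indep by (auto simp: indep_size_def)
  then show ?case by simp
next
  case (Suc n)
  have fin: "finite (indep_size I m)" for m using finite_I by (simp add: indep_size_def)
  have fin': "\<forall>U\<in>indep_size I m. finite U" for m using finite_indep by (simp add: indep_size_def)
  have "(\<Sum>S\<in>indep_size I n. (\<Prod>x\<in>S. \<omega> x) * (\<Sum>x\<in>Cont X I S. \<omega> x * f (insert x S)))
      = (\<Sum>(S, x)\<in>Sigma (indep_size I n) (Cont X I). (\<Prod>x\<in>insert x S. \<omega> x) * f (insert x S))"
    unfolding sum_distrib_left sum.Sigma[OF fin ballI[OF finite_Cont], symmetric]
    by (intro sum.cong refl) (auto simp: in_Cont_iff indep_size_def finite_indep)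
  \<comment> \<open>A set with a continuation is traded for the enlarged set with a marked element;
    each \<open>U\<close> then occurs once for each of its \<open>Suc n\<close> elements.\<close>
  also have "\<dots> = (\<Sum>(U, x)\<in>Sigma (indep_size I (Suc n)) (\<lambda>U. U). (\<Prod>x\<in>U. \<omega> x) * f U)"
    by (rule sum.reindex_bij_witness[of _ "\<lambda>(U, x). (U - {x}, x)" "\<lambda>(S, x). (insert x S, x)"])
      (use indep_subset in \<open>auto simp: in_Cont_iff indep_size_def finite_indep insert_absorb
        dest: subsetD[OF indep_subset_ground]\<close>)
  also have "\<dots> = (\<Sum>U\<in>indep_size I (Suc n). \<Sum>x\<in>U. (\<Prod>x\<in>U. \<omega> x) * f U)"
    by (rule sum.Sigma[OF fin fin', symmetric])
  also have "\<dots> = real (Suc n) * (\<Sum>U\<in>indep_size I (Suc n). (\<Prod>x\<in>U. \<omega> x) * f U)"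
    unfolding sum_distrib_left by (intro sum.cong refl) (auto simp: indep_size_def)
  finally show ?case unfolding ext_sum_Suc_right Suc by simp
qed

lemma ext_count_empty: "ext_count n {} = fact n * weighted_count I \<omega> n"
  by (simp add: ext_sum_empty weighted_count_def)

text \<open>\<open>lin_form\<close> is the polarization of the form \<open>quadratic\<close> between \<open>(1, 0)\<close> and \<open>(g, \<tau>)\<close>.\<close>

definition lin_form :: "nat \<Rightarrow> ('a \<Rightarrow> real) \<Rightarrow> real \<Rightarrow> 'a set \<Rightarrow> real"
  where "lin_form n g \<tau> S = ext_sum n (\<lambda>T. (\<Sum>x\<in>Cont X I T. \<omega> x * (\<Sum>y\<in>Cont X I (insert x T). \<omega> y * g y))
    + \<tau> * (\<Sum>x\<in>Cont X I T. \<omega> x)) S"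

definition quadratic :: "real \<Rightarrow> nat \<Rightarrow> ('a \<Rightarrow> real) \<Rightarrow> real \<Rightarrow> 'a set \<Rightarrow> real"
  where "quadratic \<beta> n g \<tau> S = ext_sum n (\<lambda>T.
      (\<Sum>x\<in>Cont X I T. \<omega> x * (g x * (\<Sum>y\<in>Cont X I (insert x T). \<omega> y * g y)))
    + (2 * \<tau> * (\<Sum>x\<in>Cont X I T. \<omega> x * g x) + \<beta> * \<tau>\<^sup>2 * 1)) S"

lemma quadratic_Suc: "quadratic \<beta> (Suc n) g \<tau> S = (\<Sum>x\<in>Cont X I S. \<omega> x * quadratic \<beta> n g \<tau> (insert x S))"
  by (simp add: quadratic_def)

lemma lin_form_Suc: "lin_form (Suc n) g \<tau> S = (\<Sum>x\<in>Cont X I S. \<omega> x * lin_form n g \<tau> (insert x S))"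
  by (simp add: lin_form_def)

lemma ext_sum_weight:
  "ext_sum n (\<lambda>T. \<Sum>x\<in>Cont X I T. \<omega> x * g x) S = (\<Sum>x\<in>Cont X I S. \<omega> x * (g x * ext_count n (insert x S)))"
proof -
  have "ext_sum n (\<lambda>_. g x) T = g x * ext_count n T" for x T
    using ext_sum_scale[of n "g x" "\<lambda>_. 1"] by simp
  then show ?thesis using ext_sum_Cont[of n "\<lambda>x T. g x" S] by simp
qed

lemma ext_sum_weight2:
  "ext_sum n (\<lambda>T. \<Sum>x\<in>Cont X I T. \<omega> x * (g x * (\<Sum>y\<in>Cont X I (insert x T). \<omega> y * h y))) S
    = (\<Sum>x\<in>Cont X I S. \<omega> x * (g x * (\<Sum>y\<in>Cont X I (insert x S). \<omega> y * (h y * ext_count n (insert y (insert x S))))))"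
  using ext_sum_Cont[of n "\<lambda>x T. g x * (\<Sum>y\<in>Cont X I T. \<omega> y * h y)" S]
  by (simp only: ext_sum_scale ext_sum_weight)

text \<open>The matrix of the form: the \<open>X\<close>-block consists of two-step extensions of
  \<open>S\<close>, the mixed column of one-step extensions, and the corner is
  \<open>\<beta> * ext_count n S\<close>.\<close>

lemma quadratic_eq:
  "quadratic \<beta> n g \<tau> S
    = (\<Sum>x\<in>Cont X I S. \<omega> x * (g x * (\<Sum>y\<in>Cont X I (insert x S). \<omega> y * (g y * ext_count n (insert y (insert x S))))))
    + (2 * \<tau> * (\<Sum>x\<in>Cont X I S. \<omega> x * (g x * ext_count n (insert x S))) + \<beta> * \<tau>\<^sup>2 * ext_count n S)"
  unfolding quadratic_def by (simp only: ext_sum_add ext_sum_scale ext_sum_weight ext_sum_weight2)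

lemma lin_form_eq_right:
  "lin_form n g \<tau> S
    = (\<Sum>x\<in>Cont X I S. \<omega> x * (\<Sum>y\<in>Cont X I (insert x S). \<omega> y * (g y * ext_count n (insert y (insert x S)))))
    + \<tau> * (\<Sum>x\<in>Cont X I S. \<omega> x * ext_count n (insert x S))"
  unfolding lin_form_def
  using ext_sum_weight2[of n "\<lambda>_. 1" g S] ext_sum_weight[of n "\<lambda>_. 1" S]
  by (simp add: ext_sum_add ext_sum_scale)

lemma lin_form_eq_left:
  "lin_form n g \<tau> S
    = (\<Sum>x\<in>Cont X I S. \<omega> x * (g x * (\<Sum>y\<in>Cont X I (insert x S). \<omega> y * ext_count n (insert y (insert x S)))))
    + \<tau> * (\<Sum>x\<in>Cont X I S. \<omega> x * ext_count n (insert x S))"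
proof -
  have "(\<Sum>x\<in>Cont X I S. \<Sum>y\<in>Cont X I (insert x S). \<omega> x * (\<omega> y * (g y * ext_count n (insert y (insert x S)))))
      = (\<Sum>x\<in>Cont X I S. \<Sum>y\<in>Cont X I (insert x S). \<omega> x * (g x * (\<omega> y * ext_count n (insert y (insert x S)))))"
    by (subst sum_Cont_swap) (simp add: insert_commute mult.left_commute)
  then show ?thesis by (simp add: lin_form_eq_right sum_distrib_left)
qed

lemma lin_form_gradient:
  "lin_form n g \<tau> S = (\<Sum>x\<in>Cont X I S. \<omega> x * (g x * ext_count (Suc n) (insert x S))) + \<tau> * ext_count (Suc n) S"
  by (simp add: lin_form_eq_left)

lemma lin_form_shift:
  "lin_form n (\<lambda>x. g x + t) \<tau> S = lin_form n g \<tau> S + t * ext_count (Suc (Suc n)) S"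
  unfolding lin_form_gradient by (simp add: algebra_simps sum.distrib sum_distrib_left)

text \<open>Bilinear expansion along (1, 0), on which the form has the value
  \<open>ext_count (Suc (Suc n)) S\<close>. The two cross terms are \<open>lin_form_eq_left\<close>
  and \<open>lin_form_eq_right\<close>.\<close>

lemma quadratic_shift:
  "quadratic \<beta> n (\<lambda>x. g x + t) \<tau> S
    = quadratic \<beta> n g \<tau> S + 2 * t * lin_form n g \<tau> S + t\<^sup>2 * ext_count (Suc (Suc n)) S"
proof -
  let ?H = "\<lambda>x. \<Sum>y\<in>Cont X I (insert x S). \<omega> y * ext_count n (insert y (insert x S))"
  let ?G = "\<lambda>x. \<Sum>y\<in>Cont X I (insert x S). \<omega> y * (g y * ext_count n (insert y (insert x S)))"
  have L: "2 * lin_form n g \<tau> S = (\<Sum>x\<in>Cont X I S. \<omega> x * ?G x) + (\<Sum>x\<in>Cont X I S. \<omega> x * (g x * ?H x))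
      + 2 * \<tau> * (\<Sum>x\<in>Cont X I S. \<omega> x * ext_count n (insert x S))"
    using lin_form_eq_left[of n g \<tau> S] lin_form_eq_right[of n g \<tau> S] by simp
  have 1: "(\<Sum>y\<in>Cont X I (insert x S). \<omega> y * ((g y + t) * ext_count n (insert y (insert x S)))) = ?G x + t * ?H x" for x
    by (simp add: algebra_simps sum.distrib sum_distrib_left)
  have 2: "(\<Sum>x\<in>Cont X I S. \<omega> x * ((g x + t) * (G x + t * H x)))
      = (\<Sum>x\<in>Cont X I S. \<omega> x * (g x * G x)) + t * ((\<Sum>x\<in>Cont X I S. \<omega> x * G x)
        + (\<Sum>x\<in>Cont X I S. \<omega> x * (g x * H x))) + t\<^sup>2 * (\<Sum>x\<in>Cont X I S. \<omega> x * H x)" for G H :: "'a \<Rightarrow> real"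
    by (simp add: algebra_simps sum.distrib sum_distrib_left power2_eq_square)
  have 3: "(\<Sum>x\<in>Cont X I S. \<omega> x * ((g x + t) * ext_count n (insert x S)))
      = (\<Sum>x\<in>Cont X I S. \<omega> x * (g x * ext_count n (insert x S))) + t * (\<Sum>x\<in>Cont X I S. \<omega> x * ext_count n (insert x S))"
    by (simp add: algebra_simps sum.distrib sum_distrib_left)
  have 4: "ext_count (Suc (Suc n)) S = (\<Sum>x\<in>Cont X I S. \<omega> x * ?H x)" by simp
  have "2 * t * lin_form n g \<tau> S = t * (2 * lin_form n g \<tau> S)" by simp
  then show ?thesis unfolding quadratic_eq 1 2 3 4 L by (simp add: algebra_simps)
qed

section \<open>Reversed Cauchy-Schwarz inequality and induction on the level\<close>

text \<open>The shift by \<open>t\<close> removes the component along (1, 0), and the hypothesis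
  applies to the remainder.\<close>

lemma quadratic_Cauchy_Schwarz:
  assumes pos: "0 < ext_count (Suc (Suc n)) S"
    and hyp: "\<And>g. lin_form n g \<tau> S = 0 \<Longrightarrow> quadratic \<beta> n g \<tau> S \<le> 0"
  shows "quadratic \<beta> n g \<tau> S \<le> (lin_form n g \<tau> S)\<^sup>2 / ext_count (Suc (Suc n)) S"
proof -
  define L where "L = ext_count (Suc (Suc n)) S"
  define t where "t = - lin_form n g \<tau> S / L"
  have L: "0 < L" using pos by (simp only: L_def)
  have "lin_form n (\<lambda>x. g x + t) \<tau> S = 0"
    unfolding lin_form_shift L_def[symmetric] using L by (simp add: t_def)
  then have "quadratic \<beta> n g \<tau> S + 2 * t * lin_form n g \<tau> S + t\<^sup>2 * L \<le> 0"
    using hyp[of "\<lambda>x. g x + t"] unfolding quadratic_shift L_def[symmetric] by simp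
  then show ?thesis
    unfolding L_def[symmetric] using L by (simp add: t_def power2_eq_square field_simps)
qed

text \<open>The inductive step applies \<open>reversible_kernel\<close> to the Hessian on \<open>Cont S\<close>: by the identity
  \<open>lin_form_gradient\<close>, its rows are the linear forms at \<open>insert x S\<close>, and Cauchy-Schwarz there is
  the hypothesis on the kernel.\<close>

lemma hyperbolic_step:
  assumes S: "S \<in> I" and size: "card S + m + 3 \<le> rk I"
    and hyp: "\<And>x g \<tau>. x \<in> Cont X I S \<Longrightarrow> lin_form m g \<tau> (insert x S) = 0 \<Longrightarrow> quadratic \<beta> m g \<tau> (insert x S) \<le> 0"
    and lin: "lin_form (Suc m) g \<tau> S = 0"
  shows "quadratic \<beta> (Suc m) g \<tau> S \<le> 0"
    and "quadratic \<beta> (Suc m) g \<tau> S = 0 \<Longrightarrow> x \<in> Cont X I S \<Longrightarrow> lin_form m g \<tau> (insert x S) = 0"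
proof -
  let ?Y = "Cont X I S"
  define K where "K x y = (if y \<in> Cont X I (insert x S)
    then \<omega> x * (\<omega> y * ext_count (Suc m) (insert y (insert x S))) else 0)" for x y
  let ?E = "SIGMA x : ?Y. Cont X I (insert x S)"
  \<comment> \<open>The least nonzero entry of the kernel.\<close>
  define \<kappa> where "\<kappa> = Min ((\<lambda>(x, y). K x y) ` ?E)"
  have cardS: "card (insert x S) = Suc (card S)" "insert x S \<in> I" if "x \<in> ?Y" for x
    using that S by (auto simp: in_Cont_iff finite_indep)
  have K_pos: "0 < K x y" if "x \<in> ?Y" "y \<in> Cont X I (insert x S)" for x y
  proof -
    have "0 < ext_count (Suc m) (insert y (insert x S))"
      using that size S by (intro ext_count_pos) (auto simp: in_Cont_iff finite_indep)
    then show ?thesis using that by (simp add: K_def Cont_weight_pos)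
  qed
  obtain x0 where x0: "x0 \<in> ?Y" using Cont_nonempty[OF S] size by auto
  have ex: "\<exists>y. y \<in> Cont X I (insert x S)" if "x \<in> ?Y" for x
    using cardS[OF that] size by (metis Cont_nonempty add_Suc_right add_lessD1 less_eq_Suc_le numeral_3_eq_3 add_Suc)
  have finE: "finite ?E" by (intro finite_SigmaI finite_Cont)
  have neE: "?E \<noteq> {}" using x0 ex by auto
  have \<kappa>_le: "\<kappa> \<le> K x y" if "x \<in> ?Y" "y \<in> Cont X I (insert x S)" for x y
    unfolding \<kappa>_def using finE that by (intro Min_le) force+
  have swap: "y \<in> Cont X I (insert x S) \<longleftrightarrow> x \<in> Cont X I (insert y S)" if "x \<in> ?Y" "y \<in> ?Y" for x y
    using that Cont_insert_swap by blast
  have par: "y \<notin> Cont X I (insert x S) \<longleftrightarrow> (x, y) \<in> parallel X I S" if "x \<in> ?Y" "y \<in> ?Y" for x y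
    using Cont_insert_iff that by simp
  have equiv: "equiv ?Y (parallel X I S)" using S by (rule equiv_parallel)
  interpret reversible_kernel ?Y K \<kappa>
  proof
    show "finite ?Y" by simp
    show "K x y = K y x" if "x \<in> ?Y" "y \<in> ?Y" for x y
      using swap[OF that] by (simp add: K_def insert_commute mult.left_commute)
    show "0 \<le> K x y" if "x \<in> ?Y" "y \<in> ?Y" for x y
      using K_pos[of x y] that by (cases "y \<in> Cont X I (insert x S)") (auto simp: K_def)
    show "0 < \<kappa>" unfolding \<kappa>_def using finE neE K_pos by (subst Min_gr_iff) auto
    fix x y assume xy: "x \<in> ?Y" "y \<in> ?Y"
    show "\<kappa> \<le> K x y \<or> (\<exists>z\<in>?Y. \<kappa> \<le> K x z \<and> \<kappa> \<le> K z y)"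
    proof (cases "y \<in> Cont X I (insert x S)")
      \<comment> \<open>Here \<open>y\<close> equals \<open>x\<close> or is parallel to it. A
        continuation \<open>z\<close> of \<open>insert x S\<close> is not parallel to
        \<open>x\<close>, hence by transitivity not to \<open>y\<close>, so \<open>x\<close>,
        \<open>z\<close>, \<open>y\<close> is a path.\<close>
      case False
      obtain z where z: "z \<in> Cont X I (insert x S)" using ex xy by blast
      then have zY: "z \<in> ?Y" using xy Cont_insert_swap by blast
      have "y \<in> Cont X I (insert z S)"
        using False z xy zY par swap equiv
        by (meson equivE symE transE)
      then show ?thesis using z zY \<kappa>_le xy by blast
    qed (use \<kappa>_le xy in blast)
  qed
  have K_sum: "(\<Sum>y\<in>?Y. K x y * u y)
      = \<omega> x * (\<Sum>y\<in>Cont X I (insert x S). \<omega> y * (u y * ext_count (Suc m) (insert y (insert x S))))"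
    if x: "x \<in> ?Y" for x u
  proof -
    have "(\<Sum>y\<in>?Y. K x y * u y) = (\<Sum>y\<in>Cont X I (insert x S). K x y * u y)"
      using x Cont_insert_swap by (intro sum.mono_neutral_right) (auto simp: K_def)
    also have "\<dots> = (\<Sum>y\<in>Cont X I (insert x S).
        \<omega> x * (\<omega> y * (u y * ext_count (Suc m) (insert y (insert x S)))))"
      by (intro sum.cong refl) (simp add: K_def algebra_simps)
    finally show ?thesis by (simp only: sum_distrib_left)
  qed
  \<comment> \<open>Division by \<open>w\<close> makes \<open>ip c g\<close> the mixed term of the
    form; the corner entry enters \<open>quad_form\<close> as
    \<open>\<beta> * ext_count (Suc m) S\<close>.\<close>
  define c where "c x = \<omega> x * ext_count (Suc m) (insert x S) / w x" for x
  have w_eq: "w x = \<omega> x * ext_count (Suc (Suc m)) (insert x S)" if "x \<in> ?Y" for x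
    using K_sum[OF that, of "\<lambda>_. 1"] unfolding w_def by (simp del: ext_sum.simps add: ext_sum.simps(2)[of "Suc m"])
  have aff_eq: "w x * aff c g \<tau> x = \<omega> x * lin_form m g \<tau> (insert x S)" if "x \<in> ?Y" for x g \<tau>
  proof -
    have "w x * aff c g \<tau> x = (\<Sum>y\<in>?Y. K x y * g y) + \<tau> * (\<omega> x * ext_count (Suc m) (insert x S))"
      using w_pos[OF that] by (simp add: aff_def B_def c_def field_simps)
    then show ?thesis unfolding K_sum[OF that] lin_form_gradient by (simp only: algebra_simps)
  qed
  have quad_eq: "quad_form c (\<beta> * ext_count (Suc m) S) g \<tau> = quadratic \<beta> (Suc m) g \<tau> S" for g \<tau>
  proof -
    have "ip g (B g) = (\<Sum>x\<in>?Y. g x * (\<Sum>y\<in>?Y. K x y * g y))"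
      unfolding ip_B sum_distrib_left by (intro sum.cong refl) simp
    moreover have "ip c g = (\<Sum>x\<in>?Y. \<omega> x * (g x * ext_count (Suc m) (insert x S)))"
      unfolding ip_def c_def using w_pos by (intro sum.cong refl) (force simp: field_simps)
    ultimately show ?thesis
      unfolding quad_form_def quadratic_eq by (simp add: K_sum mult.left_commute del: ext_sum.simps)
  qed
  have quad_le: "quad_form c (\<beta> * ext_count (Suc m) S) g \<tau> \<le> ip (aff c g \<tau>) (aff c g \<tau>)" for g \<tau>
    unfolding quad_eq quadratic_Suc ip_def
  proof (rule sum_mono)
    fix x assume x: "x \<in> ?Y"
    let ?L = "ext_count (Suc (Suc m)) (insert x S)"
    have L: "0 < ?L" using x cardS[OF x] size by (intro ext_count_pos) auto
    have wx: "0 < \<omega> x" using x by (rule Cont_weight_pos)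
    have a: "aff c g \<tau> x = lin_form m g \<tau> (insert x S) / ?L"
      using aff_eq[OF x, of g \<tau>] L wx unfolding w_eq[OF x] by (simp add: field_simps del: ext_sum.simps)
    have "\<omega> x * quadratic \<beta> m g \<tau> (insert x S) \<le> \<omega> x * ((lin_form m g \<tau> (insert x S))\<^sup>2 / ?L)"
      using wx L hyp[OF x] by (intro mult_left_mono quadratic_Cauchy_Schwarz) auto
    also have "\<dots> = w x * (aff c g \<tau> x * aff c g \<tau> x)"
      unfolding a w_eq[OF x] using L by (simp add: power2_eq_square del: ext_sum.simps)
    finally show "\<omega> x * quadratic \<beta> m g \<tau> (insert x S) \<le> w x * (aff c g \<tau> x * aff c g \<tau> x)" .
  qed
  have mean: "ip (\<lambda>_. 1) (aff c g \<tau>) = 0"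
    using lin aff_eq by (simp add: ip_def lin_form_Suc)
  show "quadratic \<beta> (Suc m) g \<tau> S \<le> 0"
    using quad_form_nonpos[OF quad_le mean] unfolding quad_eq .
  show "lin_form m g \<tau> (insert x S) = 0" if q: "quadratic \<beta> (Suc m) g \<tau> S = 0" and x: "x \<in> ?Y"
    using aff_eq_0[OF quad_le mean _ x] aff_eq[OF x, of g \<tau>] Cont_weight_pos[OF x]
    unfolding quad_eq using q by simp
qed

context
  fixes \<beta> :: real and j :: nat
  assumes size: "j + 2 \<le> rk I"
    and hyp: "T \<in> indep_size I j \<Longrightarrow> lin_form 0 g \<tau> T = 0 \<Longrightarrow> quadratic \<beta> 0 g \<tau> T \<le> 0"
begin

lemma hyperbolic:
  "S \<in> I \<Longrightarrow> card S + n = j \<Longrightarrow> lin_form n g \<tau> S = 0 \<Longrightarrow> quadratic \<beta> n g \<tau> S \<le> 0"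
proof (induction n arbitrary: S g \<tau>)
  case 0
  then show ?case by (intro hyp) (auto simp: indep_size_def)
next
  case (Suc n)
  show ?case
    using Suc size by (intro hyperbolic_step(1)) (auto simp: in_Cont_iff finite_indep)
qed

text \<open>By the second part of \<open>hyperbolic_step\<close> the vector stays orthogonal to (1,
  0) at every \<open>insert y S\<close>, so each summand of \<open>quadratic_Suc\<close> is
  nonpositive. A zero sum forces all of them to vanish, and the argument follows a chain from
  \<open>S\<close> up to \<open>T\<close>.\<close>

lemma equality_propagates:
  assumes "S \<in> I" "card S + n = j" "lin_form n g \<tau> S = 0" "quadratic \<beta> n g \<tau> S = 0"
    and "T \<in> indep_size I j" "S \<subseteq> T"
  shows "lin_form 0 g \<tau> T = 0 \<and> quadratic \<beta> 0 g \<tau> T = 0"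
  using assms
proof (induction n arbitrary: S)
  case 0
  then have "S = T" by (intro card_subset_eq) (auto simp: indep_size_def finite_indep)
  then show ?case using 0 by simp
next
  case (Suc n)
  have T: "T \<in> I" "card T = j" using Suc.prems by (auto simp: indep_size_def)
  then obtain x where x: "x \<in> T" "x \<notin> S" using Suc.prems by (metis add_eq_self_zero subset_antisym subsetI nat.distinct(1))
  have xC: "x \<in> Cont X I S"
    using x T Suc.prems indep_subset_ground[OF T(1)] indep_subset[OF T(1), of "insert x S"] by (auto simp: in_Cont_iff)
  have card': "card (insert y S) + n = j" "insert y S \<in> I" if "y \<in> Cont X I S" for y
    using that Suc.prems by (auto simp: in_Cont_iff finite_indep)
  have lin: "lin_form n g \<tau> (insert y S) = 0" if "y \<in> Cont X I S" for y
    using Suc.prems size that hyperbolic card'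
    by (intro hyperbolic_step(2)[of S n \<beta> g \<tau>]) auto
  have "(\<Sum>y\<in>Cont X I S. - (\<omega> y * quadratic \<beta> n g \<tau> (insert y S))) = 0"
    using Suc.prems(4) by (simp add: quadratic_Suc sum_negf)
  moreover have "0 \<le> - (\<omega> y * quadratic \<beta> n g \<tau> (insert y S))" if "y \<in> Cont X I S" for y
    using hyperbolic[OF card'(2)[OF that] card'(1)[OF that] lin[OF that]] Cont_weight_pos[OF that]
    by (simp add: mult_nonneg_nonpos less_imp_le)
  ultimately have "- (\<omega> x * quadratic \<beta> n g \<tau> (insert x S)) = 0"
    using xC by (metis (no_types, lifting) finite_Cont sum_nonneg_eq_0_iff)
  then have "quadratic \<beta> n g \<tau> (insert x S) = 0" using Cont_weight_pos[OF xC] by simp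
  then show ?case using Suc.IH[OF card'(2)[OF xC] card'(1)[OF xC] lin[OF xC]] Suc.prems x by simp
qed

end

section \<open>Parallel classes and the case of equality\<close>

lemma finite_Par: "S \<in> I \<Longrightarrow> finite (Par X I S)"
  unfolding Par_def by (intro finite_quotient) (auto simp: parallel_def)

lemma sum_Par:
  assumes "S \<in> I"
  shows "(\<Sum>x\<in>Cont X I S. f x) = (\<Sum>C\<in>Par X I S. sum f C)"
proof -
  note eq = equiv_parallel[OF assms]
  have "\<Union> (Par X I S) = Cont X I S" unfolding Par_def by (rule Union_quotient[OF eq])
  moreover have "sum f (\<Union> (Par X I S)) = (\<Sum>C\<in>Par X I S. sum f C)"
  proof (rule sum.Union_disjoint[unfolded comp_def])
    show "\<forall>C\<in>Par X I S. finite C"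
      using in_quotient_imp_subset[OF eq] finite_subset[OF _ finite_Cont] unfolding Par_def by blast
    show "\<forall>C\<in>Par X I S. \<forall>D\<in>Par X I S. C \<noteq> D \<longrightarrow> C \<inter> D = {}"
      using quotient_disj[OF eq] by (auto simp: Par_def)
  qed
  ultimately show ?thesis by simp
qed

lemma Cont_insert_Par:
  assumes S: "S \<in> I" and C: "C \<in> Par X I S" and x: "x \<in> C"
  shows "Cont X I (insert x S) = Cont X I S - C"
proof -
  note eq = equiv_parallel[OF S]
  have xS: "x \<in> Cont X I S" using in_quotient_imp_subset[OF eq] C x by (auto simp: Par_def)
  have "y \<in> C \<longleftrightarrow> (x, y) \<in> parallel X I S" for y
    using in_quotient_imp_in_rel[OF eq, of C x y] in_quotient_imp_closed[OF eq, of C x y] C x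
    unfolding Par_def by auto
  then show ?thesis using Cont_insert_iff[OF xS] by auto
qed

lemma sum_Cont_insert:
  fixes f :: "'a \<Rightarrow> real"
  assumes S: "S \<in> I" and C: "C \<in> Par X I S" and x: "x \<in> C"
  shows "(\<Sum>y\<in>Cont X I (insert x S). f y) = (\<Sum>D\<in>Par X I S. sum f D) - sum f C"
proof -
  have "C \<subseteq> Cont X I S"
    using in_quotient_imp_subset[OF equiv_parallel[OF S]] C by (simp add: Par_def)
  then show ?thesis unfolding Cont_insert_Par[OF assms] by (simp add: sum_diff sum_Par[OF S, symmetric])
qed

text \<open>Successive continuations lie in different parallel classes, so only class sums matter
  and the sum is the adjacency form of a complete graph on the classes.\<close>

lemma sum_weight_Cont_insert:
  assumes S: "S \<in> I"
  shows "(\<Sum>x\<in>Cont X I S. \<omega> x * (h x * (\<Sum>y\<in>Cont X I (insert x S). \<omega> y * g y)))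
    = (\<Sum>C\<in>Par X I S. (\<Sum>x\<in>C. \<omega> x * h x)
        * ((\<Sum>D\<in>Par X I S. \<Sum>x\<in>D. \<omega> x * g x) - (\<Sum>x\<in>C. \<omega> x * g x)))"
  unfolding sum_Par[OF S] sum_distrib_right
  by (intro sum.cong refl) (simp add: sum_Cont_insert[OF S])

lemma Par_weight_pos:
  assumes "S \<in> I" "C \<in> Par X I S"
  shows "0 < sum \<omega> C"
proof -
  note eq = equiv_parallel[OF assms(1)]
  have sub: "C \<subseteq> Cont X I S" and ne: "C \<noteq> {}"
    using in_quotient_imp_subset[OF eq] in_quotient_imp_non_empty[OF eq] assms(2) by (simp_all add: Par_def)
  then show ?thesis using Cont_weight_pos by (intro sum_pos) (auto intro: finite_subset[OF _ finite_Cont])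
qed

lemma card_Par_ge_2:
  assumes S: "S \<in> I" and size: "card S + 2 \<le> rk I"
  shows "2 \<le> card (Par X I S)"
proof -
  note eq = equiv_parallel[OF S]
  obtain x where x: "x \<in> Cont X I S" using Cont_nonempty[OF S] size by auto
  have "insert x S \<in> I" "card (insert x S) < rk I" using x size S by (auto simp: in_Cont_iff finite_indep)
  then obtain y where y: "y \<in> Cont X I (insert x S)" using Cont_nonempty by blast
  have yS: "y \<in> Cont X I S" using x y Cont_insert_swap by blast
  let ?c = "\<lambda>x. parallel X I S `` {x}"
  have "(x, y) \<notin> parallel X I S" using y Cont_insert_iff[OF x] by simp
  then have "?c x \<noteq> ?c y" using eq_equiv_class[OF _ eq yS] by blast
  then have "card {?c x, ?c y} = 2" by simp
  moreover have "{?c x, ?c y} \<subseteq> Par X I S" using x yS by (auto simp: Par_def quotientI)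
  ultimately show ?thesis using card_mono[OF finite_Par[OF S]] by metis
qed

lemma lin_form_0_Par:
  assumes S: "S \<in> I"
  defines "m \<equiv> \<lambda>g C. \<Sum>x\<in>C. \<omega> x * g x"
  shows "lin_form 0 g \<tau> S = (\<Sum>C\<in>Par X I S. sum \<omega> C * (sum (m g) (Par X I S) - m g C)) + \<tau> * sum (sum \<omega>) (Par X I S)"
  using sum_weight_Cont_insert[OF S, of "\<lambda>_. 1" g]
  by (simp add: lin_form_def m_def sum_Par[OF S, symmetric])

lemma quadratic_0_Par:
  assumes S: "S \<in> I"
  defines "m \<equiv> \<lambda>g C. \<Sum>x\<in>C. \<omega> x * g x"
  shows "quadratic \<beta> 0 g \<tau> S = (\<Sum>C\<in>Par X I S. m g C * (sum (m g) (Par X I S) - m g C))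
    + 2 * \<tau> * sum (m g) (Par X I S) + \<beta> * \<tau>\<^sup>2"
  using sum_weight_Cont_insert[OF S, of g g]
  by (simp add: quadratic_def m_def sum_Par[OF S, symmetric])

text \<open>The admissible bound on \<beta> decreases with the number of classes, so the value
  belonging to an upper bound \<open>p\<close> works for \<open>S\<close>.\<close>

lemma hyperbolic_base:
  assumes S: "S \<in> I" and size: "card S + 2 \<le> rk I"
    and p: "card (Par X I S) \<le> p" and lin: "lin_form 0 g \<tau> S = 0"
  shows "quadratic (1 + 1 / (real p - 1)) 0 g \<tau> S \<le> 0"
  unfolding quadratic_0_Par[OF S]
proof (rule multipartite_form_nonpos)
  show "1 + 1 / (real p - 1) \<le> 1 + 1 / (real (card (Par X I S)) - 1)"
    using p card_Par_ge_2[OF S size] by (intro add_left_mono divide_left_mono mult_pos_pos) auto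
qed (use lin lin_form_0_Par[OF S] finite_Par[OF S] card_Par_ge_2[OF S size] Par_weight_pos[OF S] in auto)

text \<open>The last steps are split off: the continuations of each \<open>S\<close> have total
  weight \<open>p * s\<close>, and after one of them is chosen its class of weight \<open>s\<close>
  is lost.\<close>

lemma ext_count_Par_const:
  assumes "\<And>S. S \<in> indep_size I j \<Longrightarrow> card (Par X I S) = p"
    and "\<And>S C. S \<in> indep_size I j \<Longrightarrow> C \<in> Par X I S \<Longrightarrow> sum \<omega> C = s"
  shows "ext_count (Suc j) {} = p * s * ext_count j {}"
    and "ext_count (Suc (Suc j)) {} = (p * s) * (p * s - s) * ext_count j {}"
proof -
  have 1: "(\<Sum>x\<in>Cont X I S. \<omega> x) = p * s" if S: "S \<in> indep_size I j" for S
    using assms[OF S] S by (simp add: sum_Par indep_size_def)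
  have 2: "(\<Sum>x\<in>Cont X I S. \<omega> x * (\<Sum>y\<in>Cont X I (insert x S). \<omega> y)) = (p * s) * (p * s - s)"
    if S: "S \<in> indep_size I j" for S
  proof -
    have SI: "S \<in> I" using S by (simp add: indep_size_def)
    show ?thesis
      using sum_weight_Cont_insert[OF SI, of "\<lambda>_. 1" "\<lambda>_. 1"] assms[OF S] by simp
  qed
  show "ext_count (Suc j) {} = p * s * ext_count j {}"
    unfolding ext_sum_Suc_right unfolding ext_sum_empty by (simp add: 1 sum_distrib_right[symmetric] mult.commute)
  show "ext_count (Suc (Suc j)) {} = (p * s) * (p * s - s) * ext_count j {}"
    unfolding ext_sum_Suc_right unfolding ext_sum_empty by (simp add: 2 sum_distrib_right[symmetric] mult.commute)
qed

text \<open>Equality makes the component of (0, 1) orthogonal to (1, 0) a null vector. Propagated to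
  the sets of size \<open>j\<close>, this determines their class sums; the converse is a direct
  count.\<close>

theorem ext_count_equality:
  assumes size: "j + 2 \<le> rk I"
  defines "p \<equiv> max_par X I j"
  shows "(ext_count (Suc j) {})\<^sup>2 = (1 + 1 / (real p - 1)) * ext_count j {} * ext_count (Suc (Suc j)) {}
    \<longleftrightarrow> (\<exists>s>0. \<forall>S\<in>indep_size I j. card (Par X I S) = p \<and> (\<forall>C\<in>Par X I S. sum \<omega> C = s))"
    (is "?L \<longleftrightarrow> ?R")
proof -
  define e0 where "e0 = ext_count j {}"
  define e1 where "e1 = ext_count (Suc j) {}"
  define e2 where "e2 = ext_count (Suc (Suc j)) {}"
  define \<beta> where "\<beta> = 1 + 1 / (real p - 1)"
  have pos: "0 < e0" "0 < e1" "0 < e2"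
    unfolding e0_def e1_def e2_def using size indep_empty by (auto intro!: ext_count_pos simp del: ext_sum.simps)
  have p_ge: "card (Par X I S) \<le> p" if "S \<in> indep_size I j" for S
    using that finite_I unfolding p_def max_par_def indep_size_def by (intro Max_ge) auto
  have "indep_size I j \<noteq> {}"
  proof
    assume "indep_size I j = {}"
    then have "e0 = 0" unfolding e0_def ext_sum_empty by simp
    then show False using pos(1) by simp
  qed
  then obtain S0 where S0: "S0 \<in> indep_size I j" by blast
  then have p2: "2 \<le> p"
    using p_ge[OF S0] card_Par_ge_2[of S0] size by (simp add: indep_size_def)
  have \<beta>: "0 < \<beta>" using p2 by (simp add: \<beta>_def add_pos_nonneg)
  show ?thesis
  proof
    assume ?L
    then have eq: "e1\<^sup>2 = \<beta> * e0 * e2" by (simp only: e0_def e1_def e2_def \<beta>_def)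
    \<comment> \<open>The coefficient of the projection of (0, 1) onto (1, 0): mixed value divided
      by the value on (1, 0).\<close>
    define c where "c = e1 / e2"
    have c: "0 < c" using pos by (simp add: c_def)
    have zero: "lin_form j (\<lambda>_. 0) 1 {} = e1" "quadratic \<beta> j (\<lambda>_. 0) 1 {} = \<beta> * e0"
      unfolding lin_form_gradient quadratic_eq by (simp_all add: e1_def e0_def del: ext_sum.simps)
    have lin: "lin_form j (\<lambda>_. - c) 1 {} = 0"
      using lin_form_shift[of j "\<lambda>_. 0" "- c" 1 "{}"] pos zero
      by (simp add: c_def e2_def[symmetric] del: ext_sum.simps)
    have "quadratic \<beta> j (\<lambda>_. - c) 1 {} = \<beta> * e0 - 2 * c * e1 + c\<^sup>2 * e2"
      using quadratic_shift[of \<beta> j "\<lambda>_. 0" "- c" 1 "{}"] zero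
      by (simp add: e2_def[symmetric] del: ext_sum.simps)
    also have "\<dots> = \<beta> * e0 - e1\<^sup>2 / e2" using pos by (simp add: c_def power2_eq_square)
    also have "\<dots> = 0" unfolding eq using pos by simp
    finally have quad: "quadratic \<beta> j (\<lambda>_. - c) 1 {} = 0" .
    have base: "quadratic \<beta> 0 g \<tau> T \<le> 0" if "T \<in> indep_size I j" "lin_form 0 g \<tau> T = 0" for T g \<tau>
      using that p_ge size unfolding \<beta>_def by (intro hyperbolic_base) (auto simp: indep_size_def)
    have "card (Par X I S) = p \<and> (\<forall>C\<in>Par X I S. sum \<omega> C = \<beta> / (c * real p))"
      if S: "S \<in> indep_size I j" for S
    proof -
      have SI: "S \<in> I" using S by (simp add: indep_size_def)
      let ?P = "Par X I S"
      have "lin_form 0 (\<lambda>_. - c) 1 S = 0 \<and> quadratic \<beta> 0 (\<lambda>_. - c) 1 S = 0"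
        using equality_propagates[OF size base indep_empty _ lin quad S empty_subsetI] by simp
      then have z: "lin_form 0 (\<lambda>_. - c) 1 S = 0" "quadratic \<beta> 0 (\<lambda>_. - c) 1 S = 0" by blast+
      \<comment> \<open>At \<open>S\<close>, \<open>A\<close> is the value of the form on (1, 0) and
        \<sigma> its mixed value. Expanding at (-c, 1) gives two equations, which determine
        \<open>c * A\<close> and \<open>c * \<sigma>\<close>.\<close>
      define A where "A = (\<Sum>C\<in>?P. sum \<omega> C * (sum (sum \<omega>) ?P - sum \<omega> C))"
      define \<sigma> where "\<sigma> = sum (sum \<omega>) ?P"
      have vals: "lin_form 0 (\<lambda>_. 0) 1 S = \<sigma>" "lin_form 0 (\<lambda>_. 1) 0 S = A"
        "quadratic \<beta> 0 (\<lambda>_. 0) 1 S = \<beta>"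
        unfolding lin_form_0_Par[OF SI] quadratic_0_Par[OF SI] by (simp_all add: \<sigma>_def A_def)
      have "ext_count (Suc (Suc 0)) S = A"
        unfolding vals(2)[symmetric] by (simp add: lin_form_gradient)
      then have "\<sigma> - c * A = 0" and q: "\<beta> - 2 * c * \<sigma> + c\<^sup>2 * A = 0"
        using lin_form_shift[of 0 "\<lambda>_. 0" "- c" 1 S] quadratic_shift[of \<beta> 0 "\<lambda>_. 0" "- c" 1 S] z vals
        by (simp_all del: ext_sum.simps)
      then have cA: "c * A = \<sigma>" by simp
      have "c\<^sup>2 * A = c * \<sigma>" unfolding cA[symmetric] by (simp add: power2_eq_square)
      then have c\<sigma>: "c * \<sigma> = \<beta>" using q by simp
      note eq = multipartite_form_equality[OF finite_Par[OF SI] p_ge[OF S] p2 less_imp_neq[OF c, symmetric]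
          cA[unfolded A_def \<sigma>_def] c\<sigma>[unfolded \<sigma>_def \<beta>_def], folded \<beta>_def]
      show ?thesis using eq by blast
    qed
    moreover have "0 < \<beta> / (c * real p)" using \<beta> c p2 by simp
    ultimately show ?R by blast
  next
    assume ?R
    then obtain s where s: "s > 0" "\<And>S. S \<in> indep_size I j \<Longrightarrow> card (Par X I S) = p"
      "\<And>S C. S \<in> indep_size I j \<Longrightarrow> C \<in> Par X I S \<Longrightarrow> sum \<omega> C = s" by blast
    have e: "ext_count (Suc j) {} = p * s * ext_count j {}"
      "ext_count (Suc (Suc j)) {} = (p * s) * (p * s - s) * ext_count j {}"
      using s by (blast intro: ext_count_Par_const)+
    show ?L
      unfolding e
      using p2 by (simp add: field_simps power2_eq_square)
  qed
qed

end

section \<open>Passage from ordered to unordered counts\<close>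

theorem theorem1p10:
  fixes X :: "'a set" and I :: "'a set set" and \<omega> :: "'a \<Rightarrow> real" and k :: nat
  assumes "matroid X I"
    and "1 \<le> k" and "k < rk I"
    and "\<And>x. x \<in> X \<Longrightarrow> \<omega> x > 0"
  shows "(weighted_count I \<omega> k)\<^sup>2 =
           (1 + 1 / real k) * (1 + 1 / (real (max_par X I (k - 1)) - 1)) *
           weighted_count I \<omega> (k - 1) * weighted_count I \<omega> (k + 1)
         \<longleftrightarrow>
         (\<exists>s::real. s > 0 \<and>
           (\<forall>S \<in> indep_size I (k - 1).
              card (Par X I S) = max_par X I (k - 1) \<and>
              (\<forall>C \<in> Par X I S. (\<Sum>x\<in>C. \<omega> x) = s)))"
proof -
  interpret weighted_matroid X I \<omega>
    using assms by (simp add: weighted_matroid_def weighted_matroid_axioms_def)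
  obtain j where k: "k = Suc j" using assms(2) by (cases k) auto
  define a b c where "a = weighted_count I \<omega> j" and "b = weighted_count I \<omega> (Suc j)"
    and "c = weighted_count I \<omega> (Suc (Suc j))"
  define \<beta> where "\<beta> = 1 + 1 / (real (max_par X I j) - 1)"
  \<comment> \<open>The common factor is the square of \<open>fact k\<close>; the quotient of
    \<open>fact (k - 1) * fact (k + 1)\<close> by it is the factor \<open>1 + 1 / k\<close>.\<close>
  have "(fact (Suc j) * b)\<^sup>2 = \<beta> * (fact j * a) * (fact (Suc (Suc j)) * c)
      \<longleftrightarrow> (fact j * fact (Suc j) * real k) * b\<^sup>2 = (fact j * fact (Suc j) * real k) * ((1 + 1 / real k) * \<beta> * a * c)"
  proof -
    have k0: "real k \<noteq> 0" and f1: "fact (Suc j) = real k * fact j"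
      and f2: "fact (Suc (Suc j)) = (real k + 1) * (real k * fact j)" and k1: "real k + 1 = real k * (1 + 1 / real k)"
      by (simp_all add: k field_simps)
    show ?thesis unfolding f1 f2 k1 by (simp only: power2_eq_square mult_ac)
  qed
  also have "\<dots> \<longleftrightarrow> b\<^sup>2 = (1 + 1 / real k) * \<beta> * a * c"
    using k by (subst mult_cancel_left) simp
  finally show ?thesis
    using ext_count_equality[of j] assms(3) unfolding ext_count_empty
    by (simp add: k a_def b_def c_def \<beta>_def)
qed

end
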